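(* Let $X=X_V$ be a multivariate time series with index set $V=\{1,\dots,d\}$, let $a,b\in S\subseteq V$, let $t\in\mathbb{Z}$, and let $\sigma_a(t)$ be the intervention indicator for $X_a(t)$, taking the value $\emptyset$ (idle regime) or the value $s$ (an atomic, conditional or random intervention in $X_a(t)$). Suppose that (1) $(\overline{X}_V(t-1),X_{V\setminus\{a\}}(t))\perp\!\!\!\perp\sigma_a(t)$; (2) $\{X_V(t+j): j\in\mathbb{N}\}\perp\!\!\!\perp\sigma_a(t)\mid\overline{X}_V(t)$; (3) $X_b(t+h)\perp\!\!\!\perp\sigma_a(t)\mid\overline{X}_S(t)$ for all $h\in\mathbb{N}$; (4) if $s$ is a conditional intervention, or a random intervention whose distribution depends on the past $\overline{X}_C(t-1)$ of components $C\subseteq V$, then $C\subseteq S$. Then $S$ identifies the effect of $X_a(t)$ on $X_b(t+h)$ for all $h\in\mathbb{N}$, and the average causal effect $\mathrm{ACE}_s=\mathbb{E}_{\sigma_a(t)=s}X_b(t+h)$ is given by $$\mathbb{E}_s X_b(t+h)=\mathbb{E}_\emptyset\,\mathbb{E}_s^{\overline{X}_a(t-1),\,\overline{X}_{S\setminus\{a\}}(t)}\,\mathbb{E}_\emptyset^{\overline{X}_S(t)}X_b(t+h)\qquad\text{for all }h\in\mathbb{N}.$$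
   Context: Time series. $X=\{X(t),t\in\mathbb{Z}\}$, $X(t)=(X_1(t),\dots,X_d(t))'$, is (in the idle regime) a stationary, mixing stochastic process whose conditional distributions $\mathbb{P}(X(t+1)\mid\overline{X}(t))$ have regular, almost surely absolutely continuous versions. For $A\subseteq V$, $X_A$ is the subprocess with components $X_a$, $a\in A$, and $\overline{X}_A(t)=\{X_A(u):u\le t\}$ is its history up to and including time $t$. $\mathbb{N}=\{1,2,\dots\}$. Regimes. $\sigma_a(t)$ is not a random variable; it is a parameter indexing the different joint distributions of $X$ under the regimes considered. $\sigma_a(t)=\emptyset$ is the idle (observational) regime, in which $X_a(t)$ arises without intervention. $\sigma_a(t)=s$ is one of the following. - Atomic intervention, $s=x^*$ in the domain of $X_a(t)$: the conditional law of $X_a(t)$ given $\overline{X}_V(t-1)$ is the point mass at $x^*$. - Conditional intervention, $s=g$, a function of $\overline{x}_C(t-1)$ for some $C\subset V$: the conditional law of $X_a(t)$ given $\overline{X}_V(t-1)$ is the point mass at $g(\overline{X}_C(t-1))$. - Random intervention: the conditional law of $X_a(t)$ given $\overline{X}_V(t-1)$ is a known distribution, possibly a function of $\overline{X}_C(t-1)$ for some $C\subseteq V$. Independence of $\sigma$. $Y\perp\!\!\!\perp\sigma_a(t)$ means that the distribution of $Y$ is the same under all regimes considered. $Y\perp\!\!\!\perp\sigma_a(t)\mid Z$ means that the conditional distribution of $Y$ given $Z$ is the same under all regimes considered, i.e. there is one version of the conditional distribution of $Y$ given $Z$ that is valid under every regime. Expectations. $\mathbb{E}_\emptyset$ and $\mathbb{E}_s=\mathbb{E}_{\sigma_a(t)=s}$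 denote expectation under the idle regime and under intervention $s$. $\mathbb{E}_\emptyset^{Z}$ and $\mathbb{E}_s^{Z}$ denote conditional expectation given $Z$ under the respective regimes. The expectations involved are assumed to exist. In the displayed formula, $\mathbb{E}_\emptyset^{\overline{X}_S(t)}X_b(t+h)$ is taken to be the version common to both regimes (which exists by (3)), viewed as a function of $\overline{X}_S(t)$; its conditional expectation given $(\overline{X}_a(t-1),\overline{X}_{S\setminus\{a\}}(t))$ is then taken under regime $s$, giving a function of $(\overline{X}_a(t-1),\overline{X}_{S\setminus\{a\}}(t))$; finally the expectation of that function is taken under the idle regime. Identification. "$S$ identifies the effect of $X_a(t)$ on $X_b(t+h)$" means that the average causal effect can be expressed, via the displayed formula, in terms of the idle-regime distribution of $X_S$ and the known intervention distribution.
   Formalization: For a random intervention, the effect is expressed by the prescribed law only if the draw is independent of the contemporaneous variables given the past (otherwise that law does not determine it); in general the actual conditional law of X_a(t) under s is used. The displayed formula is unrestricted. *)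

theory Defs
  imports "HOL-Probability.Probability"
begin

section \<open>Subprocesses\<close>

text \<open>
  A process is a map \<^term>\<open>X :: int \<Rightarrow> nat \<Rightarrow> 'w \<Rightarrow> real\<close> (time, component, outcome).  Collections of
  variables such as $\overline{X}_A(t)$ or $X_A$ are random elements of a product space, indexed by
  the set of pairs (time, component) involved.
\<close>

type_synonym path = "int \<times> nat \<Rightarrow> real"

definition paths :: "(int \<times> nat) set \<Rightarrow> path measure" where
  "paths I = (\<Pi>\<^sub>M i\<in>I. borel)"

definition obs :: "(int \<Rightarrow> nat \<Rightarrow> 'w \<Rightarrow> real) \<Rightarrow> (int \<times> nat) set \<Rightarrow> 'w \<Rightarrow> path" where
  "obs X I \<omega> = (\<lambda>i\<in>I. X (fst i) (snd i) \<omega>)"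

definition past :: "nat set \<Rightarrow> int \<Rightarrow> (int \<times> nat) set" where
  "past A t = {..t} \<times> A"

definition future :: "nat set \<Rightarrow> int \<Rightarrow> (int \<times> nat) set" where
  "future A t = {t<..} \<times> A"

text \<open>The index set of $(\overline{X}_a(t-1), \overline{X}_{S\setminus\{a\}}(t))$.\<close>

definition past_without :: "nat set \<Rightarrow> nat \<Rightarrow> int \<Rightarrow> (int \<times> nat) set" where
  "past_without S a t = past {a} (t - 1) \<union> past (S - {a}) t"


section \<open>Conditional distributions and conditional expectations\<close>

text \<open>\<open>K\<close> is a regular version of the conditional distribution of \<open>Y\<close> (with values in \<open>L\<close>)
  given \<open>Z\<close> (with values in \<open>N\<close>) under \<open>M\<close>.\<close>

definition cond_distribution ::
  "'w measure \<Rightarrow> ('w \<Rightarrow> 'z) \<Rightarrow> 'z measure \<Rightarrow> ('w \<Rightarrow> 'y) \<Rightarrow> 'y measure \<Rightarrow> ('z \<Rightarrow> 'y measure) \<Rightarrow> bool" where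
  "cond_distribution M Z N Y L K \<longleftrightarrow>
     Z \<in> M \<rightarrow>\<^sub>M N \<and> Y \<in> M \<rightarrow>\<^sub>M L \<and> K \<in> N \<rightarrow>\<^sub>M prob_algebra L \<and>
     (\<forall>B\<in>sets N. \<forall>C\<in>sets L.
        emeasure M {\<omega>\<in>space M. Z \<omega> \<in> B \<and> Y \<omega> \<in> C}
          = (\<integral>\<^sup>+ z\<in>B. emeasure (K z) C \<partial>distr M N Z))"

text \<open>\<open>f\<close>, a function of the value of \<open>Z\<close>, is a version of the conditional expectation of \<open>Y\<close>
  given \<open>Z\<close> under \<open>M\<close>.\<close>

definition cond_expectation ::
  "'w measure \<Rightarrow> ('w \<Rightarrow> 'z) \<Rightarrow> 'z measure \<Rightarrow> ('w \<Rightarrow> real) \<Rightarrow> ('z \<Rightarrow> real) \<Rightarrow> bool" where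
  "cond_expectation M Z N Y f \<longleftrightarrow>
     f \<in> borel_measurable N \<and>
     (AE \<omega> in M. f (Z \<omega>) = real_cond_exp M (vimage_algebra (space M) Z N) Y \<omega>)"


section \<open>Regimes\<close>

text \<open>
  \<open>Conditional C g\<close> sets $X_a(t)$ to $g(\overline{X}_C(t-1))$; \<open>Random C \<kappa>\<close> draws it from
  $\kappa(\overline{X}_C(t-1))$, where $C = \emptyset$ is the case of a fixed distribution.
\<close>

datatype intervention =
    Atomic real
  | Conditional "nat set" "path \<Rightarrow> real"
  | Random "nat set" "path \<Rightarrow> real measure"

datatype regime = Idle | Do intervention

fun admissible_intervention :: "nat set \<Rightarrow> int \<Rightarrow> intervention \<Rightarrow> bool" where
  "admissible_intervention V t (Atomic x) \<longleftrightarrow> True"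
| "admissible_intervention V t (Conditional C g) \<longleftrightarrow>
     C \<subseteq> V \<and> g \<in> borel_measurable (paths (past C (t - 1)))"
| "admissible_intervention V t (Random C \<kappa>) \<longleftrightarrow>
     C \<subseteq> V \<and> \<kappa> \<in> paths (past C (t - 1)) \<rightarrow>\<^sub>M prob_algebra borel"

text \<open>Components on whose past the intervention depends.\<close>

fun intervention_components :: "intervention \<Rightarrow> nat set" where
  "intervention_components (Atomic x) = {}"
| "intervention_components (Conditional C g) = C"
| "intervention_components (Random C \<kappa>) = C"

text \<open>The distribution prescribed by the intervention, as a function of any path \<open>z\<close> that covers
  the past up to time \<open>t - 1\<close> of the components used.\<close>

fun intervention_law :: "intervention \<Rightarrow> int \<Rightarrow> path \<Rightarrow> real measure" where
  "intervention_law (Atomic x) t z = return borel x"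
| "intervention_law (Conditional C g) t z = return borel (g (restrict z (past C (t - 1))))"
| "intervention_law (Random C \<kappa>) t z = \<kappa> (restrict z (past C (t - 1)))"

text \<open>
  The regimes are probability measures \<open>P r\<close> on one measurable space carrying the process; only
  those with index in \<open>R\<close> are considered.
\<close>

definition process_under_regimes ::
  "(regime \<Rightarrow> 'w measure) \<Rightarrow> regime set \<Rightarrow> nat set \<Rightarrow> (int \<Rightarrow> nat \<Rightarrow> 'w \<Rightarrow> real) \<Rightarrow> bool" where
  "process_under_regimes P R V X \<longleftrightarrow>
     (\<forall>r\<in>R. prob_space (P r) \<and> sets (P r) = sets (P Idle) \<and>
        (\<forall>u. \<forall>c\<in>V. X u c \<in> borel_measurable (P r)))"

definition under_intervention ::
  "(regime \<Rightarrow> 'w measure) \<Rightarrow> nat set \<Rightarrow> (int \<Rightarrow> nat \<Rightarrow> 'w \<Rightarrow> real) \<Rightarrow> nat \<Rightarrow> int \<Rightarrow> intervention \<Rightarrow> bool"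
where
  "under_intervention P V X a t s \<longleftrightarrow>
     admissible_intervention V t s \<and>
     cond_distribution (P (Do s)) (obs X (past V (t - 1))) (paths (past V (t - 1)))
       (X t a) borel (intervention_law s t)"

text \<open>$Y \perp\!\!\!\perp \sigma$ and $Y \perp\!\!\!\perp \sigma \mid Z$.\<close>

definition indep_regime ::
  "(regime \<Rightarrow> 'w measure) \<Rightarrow> regime set \<Rightarrow> ('w \<Rightarrow> 'y) \<Rightarrow> 'y measure \<Rightarrow> bool" where
  "indep_regime P R Y L \<longleftrightarrow> (\<forall>r\<in>R. \<forall>r'\<in>R. distr (P r) L Y = distr (P r') L Y)"

definition cond_indep_regime ::
  "(regime \<Rightarrow> 'w measure) \<Rightarrow> regime set \<Rightarrow> ('w \<Rightarrow> 'y) \<Rightarrow> 'y measure \<Rightarrow> ('w \<Rightarrow> 'z) \<Rightarrow> 'z measure \<Rightarrow> bool"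
where
  "cond_indep_regime P R Y L Z N \<longleftrightarrow> (\<exists>K. \<forall>r\<in>R. cond_distribution (P r) Z N Y L K)"


section \<open>Standing assumptions on the idle regime\<close>

definition shift :: "int \<Rightarrow> (int \<Rightarrow> nat \<Rightarrow> 'w \<Rightarrow> real) \<Rightarrow> int \<Rightarrow> nat \<Rightarrow> 'w \<Rightarrow> real" where
  "shift k X u = X (u + k)"

definition stationary :: "'w measure \<Rightarrow> nat set \<Rightarrow> (int \<Rightarrow> nat \<Rightarrow> 'w \<Rightarrow> real) \<Rightarrow> bool" where
  "stationary M V X \<longleftrightarrow>
     (\<forall>k. distr M (paths (UNIV \<times> V)) (obs (shift k X) (UNIV \<times> V))
        = distr M (paths (UNIV \<times> V)) (obs X (UNIV \<times> V)))"

text \<open>Mixing in the sense of ergodic theory, for the shift on path space.\<close>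

definition mixing :: "'w measure \<Rightarrow> nat set \<Rightarrow> (int \<Rightarrow> nat \<Rightarrow> 'w \<Rightarrow> real) \<Rightarrow> bool" where
  "mixing M V X \<longleftrightarrow>
     (\<forall>A\<in>sets (paths (UNIV \<times> V)). \<forall>B\<in>sets (paths (UNIV \<times> V)).
        (\<lambda>n. measure M {\<omega>\<in>space M. obs X (UNIV \<times> V) \<omega> \<in> A \<and>
                                   obs (shift (int n) X) (UNIV \<times> V) \<omega> \<in> B})
        \<longlonglongrightarrow> measure M {\<omega>\<in>space M. obs X (UNIV \<times> V) \<omega> \<in> A} *
            measure M {\<omega>\<in>space M. obs X (UNIV \<times> V) \<omega> \<in> B})"

definition ac_transitions :: "'w measure \<Rightarrow> nat set \<Rightarrow> (int \<Rightarrow> nat \<Rightarrow> 'w \<Rightarrow> real) \<Rightarrow> bool" where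
  "ac_transitions M V X \<longleftrightarrow>
     (\<forall>t. \<exists>K. cond_distribution M (obs X (past V t)) (paths (past V t))
                (\<lambda>\<omega>. \<lambda>c\<in>V. X (t + 1) c \<omega>) (\<Pi>\<^sub>M c\<in>V. borel) K \<and>
            (AE \<omega> in M. absolutely_continuous (\<Pi>\<^sub>M c\<in>V. lborel) (K (obs X (past V t) \<omega>))))"


section \<open>Causal effects and their identification\<close>

definition ACE ::
  "(regime \<Rightarrow> 'w measure) \<Rightarrow> (int \<Rightarrow> nat \<Rightarrow> 'w \<Rightarrow> real) \<Rightarrow> intervention \<Rightarrow> nat \<Rightarrow> int \<Rightarrow> nat \<Rightarrow> real" where
  "ACE P X s b t h = (\<integral>\<omega>. X (t + int h) b \<omega> \<partial>P (Do s))"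

text \<open>\<open>f\<close> is a version, common to all regimes in \<open>R\<close>, of the conditional expectation of
  $X_b(t+h)$ given $\overline{X}_S(t)$.\<close>

definition common_cond_expectation ::
  "(regime \<Rightarrow> 'w measure) \<Rightarrow> regime set \<Rightarrow> (int \<Rightarrow> nat \<Rightarrow> 'w \<Rightarrow> real) \<Rightarrow> nat set \<Rightarrow> nat \<Rightarrow> int \<Rightarrow> nat
     \<Rightarrow> (path \<Rightarrow> real) \<Rightarrow> bool" where
  "common_cond_expectation P R X S b t h f \<longleftrightarrow>
     (\<forall>r\<in>R. cond_expectation (P r) (obs X (past S t)) (paths (past S t)) (X (t + int h) b) f)"

text \<open>
  The right-hand side of the displayed formula as a functional of the idle distribution \<open>\<mu>\<close> of
  \<open>X\<^sub>S\<close>, the regression function \<open>f\<close> and the law \<open>Q\<close> of $X_a(t)$ under intervention: the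
  middle expectation integrates out the coordinate \<open>(t, a)\<close>.
\<close>

definition adjustment_functional ::
  "path measure \<Rightarrow> nat set \<Rightarrow> nat \<Rightarrow> int \<Rightarrow> (path \<Rightarrow> real) \<Rightarrow> (path \<Rightarrow> real measure) \<Rightarrow> real" where
  "adjustment_functional \<mu> S a t f Q =
     (\<integral>x. (\<integral>y. f ((restrict x (past S t))((t, a) := y)) \<partial>Q (restrict x (past_without S a t))) \<partial>\<mu>)"

text \<open>\<open>Q\<close> is the law, under intervention, of $X_a(t)$ given
  $(\overline{X}_a(t-1), \overline{X}_{S\setminus\{a\}}(t))$.\<close>

definition draw_law ::
  "(regime \<Rightarrow> 'w measure) \<Rightarrow> (int \<Rightarrow> nat \<Rightarrow> 'w \<Rightarrow> real) \<Rightarrow> nat set \<Rightarrow> nat \<Rightarrow> int \<Rightarrow> intervention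
     \<Rightarrow> (path \<Rightarrow> real measure) \<Rightarrow> bool" where
  "draw_law P X S a t s Q \<longleftrightarrow>
     cond_distribution (P (Do s)) (obs X (past_without S a t)) (paths (past_without S a t))
       (X t a) borel Q"

text \<open>
  The definition of a random intervention fixes the law of $X_a(t)$ given $\overline{X}_V(t-1)$, but
  not its dependence on the contemporaneous variables $X_{V\setminus\{a\}}(t)$.  The following
  says that there is no such dependence given the past.
\<close>

definition draw_ignores_present ::
  "(regime \<Rightarrow> 'w measure) \<Rightarrow> nat set \<Rightarrow> (int \<Rightarrow> nat \<Rightarrow> 'w \<Rightarrow> real) \<Rightarrow> nat \<Rightarrow> int \<Rightarrow> intervention \<Rightarrow> bool"
where
  "draw_ignores_present P V X a t s \<longleftrightarrow>
     (let I = past V (t - 1) \<union> {t} \<times> (V - {a})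
      in cond_distribution (P (Do s)) (obs X I) (paths I) (X t a) borel (intervention_law s t))"

text \<open>
  \<open>S\<close> identifies the effect of $X_a(t)$ on $X_b(t+h)$: the average causal effect is the above
  functional of the idle distribution of \<open>X\<^sub>S\<close> and of the intervention law of $X_a(t)$.  For atomic
  and conditional interventions this law is the one prescribed by \<open>s\<close>, a function of the
  conditioning variables alone.  For random interventions it is the prescribed one if the draw
  does not depend on the contemporaneous variables; otherwise the prescribed law does not
  determine the effect, and the law in the formula is the conditional one.
\<close>

definition identifies_effect ::
  "(regime \<Rightarrow> 'w measure) \<Rightarrow> nat set \<Rightarrow> (int \<Rightarrow> nat \<Rightarrow> 'w \<Rightarrow> real) \<Rightarrow> nat set \<Rightarrow> nat \<Rightarrow> nat \<Rightarrow> int \<Rightarrow> nat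
     \<Rightarrow> intervention \<Rightarrow> bool" where
  "identifies_effect P V X S a b t h s \<longleftrightarrow>
     (\<exists>f. common_cond_expectation P {Idle, Do s} X S b t h f) \<and>
     (\<forall>f Q. common_cond_expectation P {Idle, Do s} X S b t h f \<and> draw_law P X S a t s Q \<longrightarrow>
        ACE P X s b t h =
          adjustment_functional (distr (P Idle) (paths (UNIV \<times> S)) (obs X (UNIV \<times> S))) S a t f Q) \<and>
     (((\<exists>C \<kappa>. s = Random C \<kappa>) \<longrightarrow> draw_ignores_present P V X a t s) \<longrightarrow>
        draw_law P X S a t s (intervention_law s t))"

end

theory Submission
  imports Defs
begin

text \<open>
  Under the intervention regime, the tower property and the version of
  $E^{\overline{X}_S(t)} X_b(t+h)$ common to both regimes, which (3) provides, give
  $E_s X_b(t+h) = E_s f(\overline{X}_S(t))$.  Condition once more on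
  $W = (\overline{X}_a(t-1), \overline{X}_{S\setminus\{a\}}(t))$: since $W$ is a subvector of the
  variables in (1), its law is the same in both regimes, so the outer expectation of the resulting
  function of $W$ may be taken under the idle regime.  If a regular conditional law \<open>Q\<close> of $X_a(t)$
  given $W$ is available, the middle expectation is an integral against \<open>Q\<close> over the coordinate
  \<open>(t, a)\<close>; by (4), the law prescribed by \<open>s\<close> depends on $W$ only and can serve as \<open>Q\<close>,
  for random \<open>s\<close> provided the draw ignores the contemporaneous variables.
\<close>


section \<open>Disintegration along a conditional distribution\<close>

lemma measurable_Pair_kernel:
  assumes K: "K \<in> N \<rightarrow>\<^sub>M subprob_algebra L" and z: "z \<in> space N"
  shows "Pair z \<in> K z \<rightarrow>\<^sub>M N \<Otimes>\<^sub>M L"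
  unfolding subprob_measurableD(3)[OF K z] by (rule measurable_Pair1'[OF z])

text \<open>Pushing \<open>K z\<close> forward along \<open>Pair z\<close> moves the parameter
  \<open>z\<close> out of the integrand and into the measure. What remains is the integral of one
  fixed function, which is measurable in the measure.\<close>

lemma integral_measurable_subprob_algebra2:
  fixes f :: "'z \<Rightarrow> 'y \<Rightarrow> real"
  assumes f [measurable]: "(\<lambda>(z, y). f z y) \<in> borel_measurable (N \<Otimes>\<^sub>M L)"
    and K [measurable]: "K \<in> N \<rightarrow>\<^sub>M subprob_algebra L"
  shows "(\<lambda>z. \<integral>y. f z y \<partial>K z) \<in> borel_measurable N"
proof -
  have "(\<lambda>z. distr (K z) (N \<Otimes>\<^sub>M L) (Pair z)) \<in> N \<rightarrow>\<^sub>M subprob_algebra (N \<Otimes>\<^sub>M L)"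
    by (rule measurable_distr2[of Pair]) measurable
  from measurable_compose[OF this integral_measurable_subprob_algebra[OF f]]
  have "(\<lambda>z. \<integral>p. (case p of (z, y) \<Rightarrow> f z y) \<partial>distr (K z) (N \<Otimes>\<^sub>M L) (Pair z)) \<in> borel_measurable N" .
  moreover have "(\<integral>p. (case p of (z, y) \<Rightarrow> f z y) \<partial>distr (K z) (N \<Otimes>\<^sub>M L) (Pair z)) = (\<integral>y. f z y \<partial>K z)"
    if "z \<in> space N" for z
    by (simp add: integral_distr[OF measurable_Pair_kernel[OF K that] f])
  ultimately show ?thesis
    by (rule measurable_cong[THEN iffD1, rotated])
qed

lemma cond_distributionD:
  assumes "cond_distribution M Z N Y L K"
  shows "Z \<in> M \<rightarrow>\<^sub>M N" "Y \<in> M \<rightarrow>\<^sub>M L" "K \<in> N \<rightarrow>\<^sub>M prob_algebra L"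
    "\<And>B C. B \<in> sets N \<Longrightarrow> C \<in> sets L \<Longrightarrow>
      emeasure M {\<omega>\<in>space M. Z \<omega> \<in> B \<and> Y \<omega> \<in> C} = (\<integral>\<^sup>+ z\<in>B. emeasure (K z) C \<partial>distr M N Z)"
  using assms unfolding cond_distribution_def by auto

text \<open>The defining identity of \<open>cond_distribution\<close> is exactly agreement of the
  two measures on rectangles. Rectangles form an intersection-stable generator of the product
  sigma-algebra and the whole space has finite mass, so agreement extends to all measurable
  sets.\<close>

lemma cond_distribution_joint_law:
  assumes K: "cond_distribution M Z N Y L K" and "prob_space M"
  shows "distr M (N \<Otimes>\<^sub>M L) (\<lambda>\<omega>. (Z \<omega>, Y \<omega>))
    = distr M N Z \<bind> (\<lambda>z. distr (K z) (N \<Otimes>\<^sub>M L) (Pair z))" (is "?J = ?B")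
proof -
  interpret prob_space M by fact
  note [measurable] = cond_distributionD(1-3)[OF K]
  have K_sub [measurable]: "K \<in> N \<rightarrow>\<^sub>M subprob_algebra L"
    by (rule measurable_prob_algebraD) measurable
  have kernel: "(\<lambda>z. distr (K z) (N \<Otimes>\<^sub>M L) (Pair z)) \<in> N \<rightarrow>\<^sub>M subprob_algebra (N \<Otimes>\<^sub>M L)"
    by (rule measurable_distr2[of Pair]) measurable
  \<comment> \<open>\<open>bind\<close> has a degenerate default value on an empty space. A
    probability space has a point, and \<open>Z\<close> maps it into \<open>space N\<close>.\<close>
  have ne: "space (distr M N Z) \<noteq> {}"
    using not_empty measurable_space[OF cond_distributionD(1)[OF K]] by auto
  have kernel': "(\<lambda>z. distr (K z) (N \<Otimes>\<^sub>M L) (Pair z)) \<in> distr M N Z \<rightarrow>\<^sub>M subprob_algebra (N \<Otimes>\<^sub>M L)"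
    using kernel by simp
  have sets_B: "sets ?B = sets (N \<Otimes>\<^sub>M L)"
    using ne subprob_measurableD(2)[OF kernel] by (intro sets_bind) auto
  show ?thesis
  proof (rule measure_eqI_generator_eq[OF Int_stable_pair_measure_generator])
    show "{A \<times> C |A C. A \<in> sets N \<and> C \<in> sets L} \<subseteq> Pow (space N \<times> space L)"
      by (auto dest: sets.sets_into_space)
    show "sets ?J = sigma_sets (space N \<times> space L) {A \<times> C |A C. A \<in> sets N \<and> C \<in> sets L}"
      by (simp add: sets_pair_measure)
    show "sets ?B = sigma_sets (space N \<times> space L) {A \<times> C |A C. A \<in> sets N \<and> C \<in> sets L}"
      by (simp add: sets_B sets_pair_measure)
    show "range (\<lambda>_::nat. space N \<times> space L) \<subseteq> {A \<times> C |A C. A \<in> sets N \<and> C \<in> sets L}"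
      by auto
    show "(\<Union>i::nat. space N \<times> space L) = space N \<times> space L"
      by simp
    show "emeasure ?J (space N \<times> space L) \<noteq> \<infinity>" for i :: nat
      by (simp add: emeasure_distr)
    fix E assume "E \<in> {A \<times> C |A C. A \<in> sets N \<and> C \<in> sets L}"
    then obtain A C where E: "E = A \<times> C" and [measurable]: "A \<in> sets N" "C \<in> sets L"
      by auto
    have "emeasure ?J E = emeasure M {\<omega>\<in>space M. Z \<omega> \<in> A \<and> Y \<omega> \<in> C}"
      unfolding E by (subst emeasure_distr) (auto intro!: arg_cong[where f="emeasure M"])
    also have "\<dots> = (\<integral>\<^sup>+ z\<in>A. emeasure (K z) C \<partial>distr M N Z)"
      by (rule cond_distributionD(4)[OF K]) measurable
    also have "\<dots> = (\<integral>\<^sup>+ z. emeasure (distr (K z) (N \<Otimes>\<^sub>M L) (Pair z)) E \<partial>distr M N Z)"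
    proof (rule nn_integral_cong)
      fix z assume "z \<in> space (distr M N Z)"
      then have z: "z \<in> space N" by simp
      have "space (K z) = space L" 
        using subprob_measurableD(1)[OF K_sub z] .
      moreover have "C \<subseteq> space L"
        by (rule sets.sets_into_space) measurable
      \<comment> \<open>The section of the rectangle at \<open>z\<close> is \<open>C\<close> or
        empty according to whether \<open>z\<close> lies in \<open>A\<close>; this produces the
        indicator of \<open>A\<close>.\<close>
      ultimately have "Pair z -` E \<inter> space (K z) = (if z \<in> A then C else {})"
        using E by auto
      moreover note measurable_Pair_kernel[OF K_sub z]
      ultimately show "emeasure (K z) C * indicator A z = emeasure (distr (K z) (N \<Otimes>\<^sub>M L) (Pair z)) E"
        using E by (simp add: emeasure_distr)
    qed
    also have "\<dots> = emeasure ?B E"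
      using E by (intro emeasure_bind[OF ne kernel', symmetric]) auto
    finally show "emeasure ?J E = emeasure ?B E" .
  qed
qed

lemma cond_distribution_nn_integral:
  assumes K: "cond_distribution M Z N Y L K" and "prob_space M"
    and g [measurable]: "g \<in> borel_measurable (N \<Otimes>\<^sub>M L)"
  shows "(\<integral>\<^sup>+ \<omega>. g (Z \<omega>, Y \<omega>) \<partial>M) = (\<integral>\<^sup>+ z. \<integral>\<^sup>+ y. g (z, y) \<partial>K z \<partial>distr M N Z)"
proof -
  note [measurable] = cond_distributionD(1-3)[OF K]
  have K_sub [measurable]: "K \<in> N \<rightarrow>\<^sub>M subprob_algebra L"
    by (rule measurable_prob_algebraD) measurable
  have kernel: "(\<lambda>z. distr (K z) (N \<Otimes>\<^sub>M L) (Pair z)) \<in> distr M N Z \<rightarrow>\<^sub>M subprob_algebra (N \<Otimes>\<^sub>M L)"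
    using measurable_distr2[of Pair N L "N \<Otimes>\<^sub>M L" K] by simp
  have "(\<integral>\<^sup>+ \<omega>. g (Z \<omega>, Y \<omega>) \<partial>M) = (\<integral>\<^sup>+ p. g p \<partial>distr M (N \<Otimes>\<^sub>M L) (\<lambda>\<omega>. (Z \<omega>, Y \<omega>)))"
    by (subst nn_integral_distr) auto
  also have "\<dots> = (\<integral>\<^sup>+ z. \<integral>\<^sup>+ p. g p \<partial>distr (K z) (N \<Otimes>\<^sub>M L) (Pair z) \<partial>distr M N Z)"
    unfolding cond_distribution_joint_law[OF K \<open>prob_space M\<close>] by (rule nn_integral_bind[OF g kernel])
  also have "\<dots> = (\<integral>\<^sup>+ z. \<integral>\<^sup>+ y. g (z, y) \<partial>K z \<partial>distr M N Z)"
  proof (rule nn_integral_cong)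
    fix z assume "z \<in> space (distr M N Z)"
    then have z: "z \<in> space N" by simp
    show "(\<integral>\<^sup>+ p. g p \<partial>distr (K z) (N \<Otimes>\<^sub>M L) (Pair z)) = (\<integral>\<^sup>+ y. g (z, y) \<partial>K z)"
      using measurable_Pair_kernel[OF K_sub z] by (subst nn_integral_distr) auto
  qed
  finally show ?thesis .
qed

text \<open>The exceptional set has a \<open>K z\<close>-null section at every \<open>z\<close>, so
  its indicator has iterated integral 0, and therefore integral 0 under the joint law.\<close>

lemma cond_distribution_AE:
  assumes K: "cond_distribution M Z N Y L K" and "prob_space M"
    and [measurable]: "Measurable.pred (N \<Otimes>\<^sub>M L) (\<lambda>p. Q (fst p) (snd p))"
    and Q: "\<And>z. z \<in> space N \<Longrightarrow> AE y in K z. Q z y"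
  shows "AE \<omega> in M. Q (Z \<omega>) (Y \<omega>)"
proof -
  note [measurable] = cond_distributionD(1-3)[OF K]
  have K_sub: "K \<in> N \<rightarrow>\<^sub>M subprob_algebra L"
    by (rule measurable_prob_algebraD) measurable
  let ?g = "\<lambda>p. indicator {p \<in> space (N \<Otimes>\<^sub>M L). \<not> Q (fst p) (snd p)} p :: ennreal"
  have "(\<integral>\<^sup>+ \<omega>. ?g (Z \<omega>, Y \<omega>) \<partial>M) = (\<integral>\<^sup>+ z. \<integral>\<^sup>+ y. ?g (z, y) \<partial>K z \<partial>distr M N Z)"
    by (rule cond_distribution_nn_integral[OF K \<open>prob_space M\<close>]) measurable
  also have "\<dots> = (\<integral>\<^sup>+ z. 0 \<partial>distr M N Z)"
  proof (rule nn_integral_cong)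
    fix z assume "z \<in> space (distr M N Z)"
    then have z: "z \<in> space N" by simp
    have "AE y in K z. ?g (z, y) = 0"
      using Q[OF z] by eventually_elim (auto simp: indicator_def)
    then have "(\<integral>\<^sup>+ y. ?g (z, y) \<partial>K z) = (\<integral>\<^sup>+ y. 0 \<partial>K z)"
      by (rule nn_integral_cong_AE)
    then show "(\<integral>\<^sup>+ y. ?g (z, y) \<partial>K z) = 0" by simp
  qed
  finally have "(\<integral>\<^sup>+ \<omega>. ?g (Z \<omega>, Y \<omega>) \<partial>M) = 0"
    by simp
  then have "AE \<omega> in M. ?g (Z \<omega>, Y \<omega>) = 0"
    by (rule nn_integral_0_iff_AE[THEN iffD1, rotated]) measurable
  \<comment> \<open>\<open>?g\<close> also vanishes outside the product space, so \<open>Q\<close>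
    can be read off from \<open>?g = 0\<close> only for pairs inside it.\<close>
  moreover have "AE \<omega> in M. (Z \<omega>, Y \<omega>) \<in> space (N \<Otimes>\<^sub>M L)"
    by (rule AE_I2) (rule measurable_space, measurable)
  ultimately show ?thesis
    by eventually_elim (auto simp: indicator_def split: if_splits)
qed

text \<open>Positive and negative parts are disintegrated separately with the nonnegative formula.
  Integrability of the whole makes both iterated integrals finite, hence \<open>g (z, _)\<close> is
  \<open>K z\<close>-integrable for almost every \<open>z\<close>; where it is not, the inner
  Bochner integral has its default value 0, on a null set.\<close>

lemma cond_distribution_integral:
  fixes g :: "'z \<times> 'y \<Rightarrow> real"
  assumes K: "cond_distribution M Z N Y L K" and "prob_space M"
    and g [measurable]: "g \<in> borel_measurable (N \<Otimes>\<^sub>M L)"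
    and int: "integrable M (\<lambda>\<omega>. g (Z \<omega>, Y \<omega>))"
  shows "integrable (distr M N Z) (\<lambda>z. \<integral>y. g (z, y) \<partial>K z)"
    and "(\<integral>\<omega>. g (Z \<omega>, Y \<omega>) \<partial>M) = (\<integral>z. \<integral>y. g (z, y) \<partial>K z \<partial>distr M N Z)"
proof -
  note [measurable] = cond_distributionD(1-3)[OF K]
  have K_sub [measurable]: "K \<in> N \<rightarrow>\<^sub>M subprob_algebra L"
    by (rule measurable_prob_algebraD) measurable
  let ?D = "distr M N Z"
  define p where "p z = (\<integral>\<^sup>+ y. ennreal (g (z, y)) \<partial>K z)" for z
  define n where "n z = (\<integral>\<^sup>+ y. ennreal (- g (z, y)) \<partial>K z)" for z
  have [measurable]: "p \<in> borel_measurable N" "n \<in> borel_measurable N"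
    unfolding p_def n_def by (rule nn_integral_measurable_subprob_algebra2[OF _ K_sub], measurable)+
  have p_eq: "(\<integral>\<^sup>+ z. p z \<partial>?D) = (\<integral>\<^sup>+ \<omega>. ennreal (g (Z \<omega>, Y \<omega>)) \<partial>M)"
    unfolding p_def
    by (rule cond_distribution_nn_integral[OF K \<open>prob_space M\<close>, symmetric, of "\<lambda>x. ennreal (g x)"]) measurable
  have n_eq: "(\<integral>\<^sup>+ z. n z \<partial>?D) = (\<integral>\<^sup>+ \<omega>. ennreal (- g (Z \<omega>, Y \<omega>)) \<partial>M)"
    unfolding n_def
    by (rule cond_distribution_nn_integral[OF K \<open>prob_space M\<close>, symmetric, of "\<lambda>x. ennreal (- g x)"]) measurable
  have p_fin: "(\<integral>\<^sup>+ z. p z \<partial>?D) \<noteq> \<infinity>" and n_fin: "(\<integral>\<^sup>+ z. n z \<partial>?D) \<noteq> \<infinity>"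
    using int unfolding p_eq n_eq real_integrable_def by auto
  have p_AE: "AE z in ?D. p z \<noteq> \<infinity>" and n_AE: "AE z in ?D. n z \<noteq> \<infinity>"
    by (rule nn_integral_noteq_infinite[OF _ p_fin], simp)
       (rule nn_integral_noteq_infinite[OF _ n_fin], simp)
  \<comment> \<open>Stated for a generic \<open>q\<close> to serve both \<open>p\<close> and
    \<open>n\<close>. \<open>enn2real\<close> sends \<infinity> to 0, which changes \<open>q\<close>
    only on a null set.\<close>
  have int_part: "integrable ?D (\<lambda>z. enn2real (q z))"
    "(\<integral>z. enn2real (q z) \<partial>?D) = enn2real (\<integral>\<^sup>+ z. q z \<partial>?D)"
    if [measurable]: "q \<in> borel_measurable N" and "(\<integral>\<^sup>+ z. q z \<partial>?D) \<noteq> \<infinity>" "AE z in ?D. q z \<noteq> \<infinity>" for q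
  proof -
    have *: "(\<integral>\<^sup>+ z. ennreal (enn2real (q z)) \<partial>?D) = (\<integral>\<^sup>+ z. q z \<partial>?D)"
      by (rule nn_integral_cong_AE, use that(3) in eventually_elim) (simp add: less_top[symmetric])
    show "integrable ?D (\<lambda>z. enn2real (q z))"
      using that(2) by (intro integrableI_nonneg) (simp_all add: * less_top[symmetric])
    show "(\<integral>z. enn2real (q z) \<partial>?D) = enn2real (\<integral>\<^sup>+ z. q z \<partial>?D)"
      by (subst integral_eq_nn_integral) (simp_all add: *)
  qed
  have AE_eq: "AE z in ?D. (\<integral>y. g (z, y) \<partial>K z) = enn2real (p z) - enn2real (n z)"
    using p_AE n_AE AE_space
  proof eventually_elim
    fix z assume "p z \<noteq> \<infinity>" "n z \<noteq> \<infinity>" "z \<in> space ?D"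
    then have z: "z \<in> space N" by simp
    have "(\<lambda>y. g (z, y)) \<in> borel_measurable (K z)"
      using measurable_compose[OF measurable_Pair_kernel[OF K_sub z] g] .
    then have "integrable (K z) (\<lambda>y. g (z, y))"
      using \<open>p z \<noteq> \<infinity>\<close> \<open>n z \<noteq> \<infinity>\<close> unfolding p_def n_def real_integrable_def by simp
    then show "(\<integral>y. g (z, y) \<partial>K z) = enn2real (p z) - enn2real (n z)"
      unfolding p_def n_def by (rule real_lebesgue_integral_def)
  qed
  have [measurable]: "(\<lambda>z. \<integral>y. g (z, y) \<partial>K z) \<in> borel_measurable N"
    by (rule integral_measurable_subprob_algebra2[OF _ K_sub]) measurable
  note p_int = int_part[OF \<open>p \<in> borel_measurable N\<close> p_fin p_AE]
    and n_int = int_part[OF \<open>n \<in> borel_measurable N\<close> n_fin n_AE]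
  show "integrable ?D (\<lambda>z. \<integral>y. g (z, y) \<partial>K z)"
    using Bochner_Integration.integrable_diff[OF p_int(1) n_int(1)]
    by (rule integrable_cong_AE[THEN iffD2, OF _ _ AE_eq, rotated -1]) measurable
  have "(\<integral>\<omega>. g (Z \<omega>, Y \<omega>) \<partial>M) = enn2real (\<integral>\<^sup>+ z. p z \<partial>?D) - enn2real (\<integral>\<^sup>+ z. n z \<partial>?D)"
    unfolding p_eq n_eq by (rule real_lebesgue_integral_def[OF int])
  also have "\<dots> = (\<integral>z. enn2real (p z) \<partial>?D) - (\<integral>z. enn2real (n z) \<partial>?D)"
    by (simp only: p_int(2) n_int(2))
  also have "\<dots> = (\<integral>z. enn2real (p z) - enn2real (n z) \<partial>?D)"
    by (rule Bochner_Integration.integral_diff[OF p_int(1) n_int(1), symmetric])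
  also have "\<dots> = (\<integral>z. \<integral>y. g (z, y) \<partial>K z \<partial>?D)"
    by (rule integral_cong_AE[OF _ _ AE_symmetric[OF AE_eq]]) measurable
  finally show "(\<integral>\<omega>. g (Z \<omega>, Y \<omega>) \<partial>M) = (\<integral>z. \<integral>y. g (z, y) \<partial>K z \<partial>?D)" .
qed

text \<open>An event about \<open>\<pi> (Z \<omega>)\<close> is an event about
  \<open>Z \<omega>\<close>, through the preimage under \<open>\<pi>\<close>. A kernel that depends
  on \<open>Z\<close> only through \<open>\<pi>\<close> therefore already satisfies the defining
  identity for the coarser conditioning variable.\<close>

lemma cond_distribution_coarsen:
  assumes K: "cond_distribution M Z N Y L (\<lambda>z. K (\<pi> z))"
    and \<pi> [measurable]: "\<pi> \<in> N \<rightarrow>\<^sub>M N'" and K' [measurable]: "K \<in> N' \<rightarrow>\<^sub>M prob_algebra L"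
  shows "cond_distribution M (\<lambda>\<omega>. \<pi> (Z \<omega>)) N' Y L K"
  unfolding cond_distribution_def
proof (intro conjI ballI)
  note Z [measurable] = cond_distributionD(1)[OF K] and Y [measurable] = cond_distributionD(2)[OF K]
  show "(\<lambda>\<omega>. \<pi> (Z \<omega>)) \<in> M \<rightarrow>\<^sub>M N'" "Y \<in> M \<rightarrow>\<^sub>M L" "K \<in> N' \<rightarrow>\<^sub>M prob_algebra L"
    by measurable
  fix B C assume [measurable]: "B \<in> sets N'" "C \<in> sets L"
  have [measurable]: "(\<lambda>z. emeasure (K z) C) \<in> borel_measurable N'"
    by (rule measurable_compose[OF measurable_prob_algebraD[OF K']]) measurable
  have "emeasure M {\<omega>\<in>space M. \<pi> (Z \<omega>) \<in> B \<and> Y \<omega> \<in> C}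
      = emeasure M {\<omega>\<in>space M. Z \<omega> \<in> \<pi> -` B \<inter> space N \<and> Y \<omega> \<in> C}"
    by (rule arg_cong[where f="emeasure M"]) (auto dest: measurable_space[OF Z])
  also have "\<dots> = (\<integral>\<^sup>+ z\<in>\<pi> -` B \<inter> space N. emeasure (K (\<pi> z)) C \<partial>distr M N Z)"
    by (rule cond_distributionD(4)[OF K]) measurable
  also have "\<dots> = (\<integral>\<^sup>+ z. emeasure (K (\<pi> z)) C * indicator B (\<pi> z) \<partial>distr M N Z)"
    by (rule nn_integral_cong) (auto simp: indicator_def)
  also have "\<dots> = (\<integral>\<^sup>+ \<omega>. emeasure (K (\<pi> (Z \<omega>))) C * indicator B (\<pi> (Z \<omega>)) \<partial>M)"
    by (subst nn_integral_distr) auto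
  also have "\<dots> = (\<integral>\<^sup>+ z\<in>B. emeasure (K z) C \<partial>distr M N' (\<lambda>\<omega>. \<pi> (Z \<omega>)))"
    by (subst nn_integral_distr) auto
  finally show "emeasure M {\<omega>\<in>space M. \<pi> (Z \<omega>) \<in> B \<and> Y \<omega> \<in> C}
      = (\<integral>\<^sup>+ z\<in>B. emeasure (K z) C \<partial>distr M N' (\<lambda>\<omega>. \<pi> (Z \<omega>)))" .
qed

text \<open>If \<open>Y\<close> is almost surely a function of \<open>Z\<close>, the event that
  \<open>Y\<close> lies in \<open>C\<close> coincides up to a null set with one about
  \<open>Z\<close>, whose conditional probability is its own indicator.\<close>

lemma cond_distribution_return:
  assumes Z [measurable]: "Z \<in> M \<rightarrow>\<^sub>M N" and Y [measurable]: "Y \<in> M \<rightarrow>\<^sub>M L"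
    and G [measurable]: "G \<in> N \<rightarrow>\<^sub>M L" and eq: "AE \<omega> in M. Y \<omega> = G (Z \<omega>)"
  shows "cond_distribution M Z N Y L (\<lambda>z. return L (G z))"
  unfolding cond_distribution_def
proof (intro conjI ballI)
  show "Z \<in> M \<rightarrow>\<^sub>M N" "Y \<in> M \<rightarrow>\<^sub>M L" by measurable
  show "(\<lambda>z. return L (G z)) \<in> N \<rightarrow>\<^sub>M prob_algebra L"
    by measurable
  fix B C assume [measurable]: "B \<in> sets N" "C \<in> sets L"
  have "emeasure M {\<omega>\<in>space M. Z \<omega> \<in> B \<and> Y \<omega> \<in> C}
      = (\<integral>\<^sup>+ \<omega>. indicator {\<omega>\<in>space M. Z \<omega> \<in> B \<and> Y \<omega> \<in> C} \<omega> \<partial>M)"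
    by (rule nn_integral_indicator[symmetric]) measurable
  also have "\<dots> = (\<integral>\<^sup>+ \<omega>. indicator C (G (Z \<omega>)) * indicator B (Z \<omega>) \<partial>M)"
    by (rule nn_integral_cong_AE, use eq AE_space in eventually_elim) (auto simp: indicator_def)
  also have "\<dots> = (\<integral>\<^sup>+ z\<in>B. emeasure (return L (G z)) C \<partial>distr M N Z)"
    by (subst nn_integral_distr) auto
  finally show "emeasure M {\<omega>\<in>space M. Z \<omega> \<in> B \<and> Y \<omega> \<in> C}
      = (\<integral>\<^sup>+ z\<in>B. emeasure (return L (G z)) C \<partial>distr M N Z)" .
qed

text \<open>Converse direction: the graph of \<open>G\<close> is a measurable set, since
  \<open>Y\<close> is real-valued, and each point mass sits on its section.\<close>

lemma cond_distribution_return_AE: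
  fixes Y :: "'w \<Rightarrow> real"
  assumes K: "cond_distribution M Z N Y borel (\<lambda>z. return borel (G z))" and "prob_space M"
    and G [measurable]: "G \<in> borel_measurable N"
  shows "AE \<omega> in M. Y \<omega> = G (Z \<omega>)"
  by (rule cond_distribution_AE[OF K \<open>prob_space M\<close>, where Q="\<lambda>z y. y = G z"])
     (auto simp: AE_return)


section \<open>Conditional expectations as functions of the conditioning variable\<close>

text \<open>Induction over nonnegative measurable functions. Sets of the generated sigma-algebra are
  preimages under \<open>Z\<close>, which settles indicators; scaling, addition and suprema act on
  the factors in the same way as on the functions.\<close>

lemma vimage_algebra_factor_ennreal:
  fixes u :: "'w \<Rightarrow> ennreal"
  assumes u: "u \<in> borel_measurable (vimage_algebra A Z N)" and Z: "Z \<in> A \<rightarrow> space N"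
  shows "\<exists>g\<in>borel_measurable N. \<forall>x\<in>A. u x = g (Z x)"
  using u
proof (induction rule: borel_measurable_induct)
  case (cong f g)
  then show ?case by simp
next
  case (set B)
  then obtain C where C: "C \<in> sets N" "B = Z -` C \<inter> A"
    using sets_vimage_algebra2[OF Z] by auto
  then show ?case
    by (intro bexI[of _ "indicator C"]) (auto simp: indicator_def)
next
  case (mult u c)
  obtain g where [measurable]: "g \<in> borel_measurable N" and g: "\<forall>x\<in>A. u x = g (Z x)"
    using mult.IH by blast
  show ?case
    by (rule bexI[of _ "\<lambda>z. c * g z"]) (simp_all add: g)
next
  case (add u v)
  obtain g where [measurable]: "g \<in> borel_measurable N" and g: "\<forall>x\<in>A. u x = g (Z x)"
    using add.IH(1) by blast
  obtain g' where [measurable]: "g' \<in> borel_measurable N" and g': "\<forall>x\<in>A. v x = g' (Z x)"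
    using add.IH(2) by blast
  show ?case
    by (rule bexI[of _ "\<lambda>z. g' z + g z"]) (simp_all add: g g')
next
  case (seq U)
  have "\<forall>i. \<exists>g. g \<in> borel_measurable N \<and> (\<forall>x\<in>A. U i x = g (Z x))"
    using seq.IH by blast
  from choice[OF this] obtain g where [measurable]: "\<And>i. g i \<in> borel_measurable N"
    and g: "\<And>i. \<forall>x\<in>A. U i x = g i (Z x)"
    by blast
  show ?case
    by (rule bexI[of _ "\<lambda>z. SUP i. g i z"]) (simp_all add: g image_image)
qed

lemma Doob_Dynkin:
  fixes u :: "'w \<Rightarrow> real"
  assumes [measurable]: "u \<in> borel_measurable (vimage_algebra A Z N)" and Z: "Z \<in> A \<rightarrow> space N"
  obtains g where "g \<in> borel_measurable N" "\<And>x. x \<in> A \<Longrightarrow> u x = g (Z x)"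
proof -
  \<comment> \<open>\<open>ennreal\<close> truncates negative numbers to 0, so \<open>g\<close> and
    \<open>g'\<close> factor the positive and the negative part of \<open>u\<close>.\<close>
  obtain g where g [measurable]: "g \<in> borel_measurable N" "\<forall>x\<in>A. ennreal (u x) = g (Z x)"
    using vimage_algebra_factor_ennreal[OF _ Z, of "\<lambda>x. ennreal (u x)"] by auto
  obtain g' where g' [measurable]: "g' \<in> borel_measurable N" "\<forall>x\<in>A. ennreal (- u x) = g' (Z x)"
    using vimage_algebra_factor_ennreal[OF _ Z, of "\<lambda>x. ennreal (- u x)"] by auto
  show ?thesis
  proof
    show "(\<lambda>z. enn2real (g z) - enn2real (g' z)) \<in> borel_measurable N" by measurable
    show "u x = enn2real (g (Z x)) - enn2real (g' (Z x))" if "x \<in> A" for x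
    proof -
      have "u x = enn2real (ennreal (u x)) - enn2real (ennreal (- u x))"
        by (cases "u x \<ge> 0") (simp_all add: ennreal_neg)
      then show ?thesis
        by (simp only: g(2)[rule_format, OF that] g'(2)[rule_format, OF that])
    qed
  qed
qed

lemma (in prob_space) sigma_finite_subalgebra_vimage:
  assumes "Z \<in> M \<rightarrow>\<^sub>M N"
  shows "sigma_finite_subalgebra M (vimage_algebra (space M) Z N)"
proof -
  have "subalgebra M (vimage_algebra (space M) Z N)"
    using assms unfolding subalgebra_def by (simp add: sets_image_in_sets)
  then show ?thesis
    by (rule finite_measure_subalgebra_is_sigma_finite[OF finite_measure_subalgebra.intro,
          OF finite_measure_axioms finite_measure_subalgebra_axioms.intro])
qed

lemma (in prob_space) ex_cond_expectation:
  assumes Z: "Z \<in> M \<rightarrow>\<^sub>M N"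
  shows "\<exists>g. cond_expectation M Z N Y g"
proof -
  obtain g where "g \<in> borel_measurable N"
    "\<And>x. x \<in> space M \<Longrightarrow> real_cond_exp M (vimage_algebra (space M) Z N) Y x = g (Z x)"
    using Doob_Dynkin[of "real_cond_exp M (vimage_algebra (space M) Z N) Y" "space M" Z N]
      measurable_space[OF Z] by auto
  then have "cond_expectation M Z N Y g"
    unfolding cond_expectation_def by auto
  then show ?thesis by blast
qed

text \<open>The tower property for versions written as functions of \<open>Z\<close>. It serves
  twice: for conditioning on the past of \<open>S\<close> and for the middle expectation given
  \<open>past_without S a t\<close>.\<close>

lemma (in prob_space) cond_expectation_integral:
  assumes Z [measurable]: "Z \<in> M \<rightarrow>\<^sub>M N" and Y: "integrable M Y" and f: "cond_expectation M Z N Y f"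
  shows "integrable M (\<lambda>\<omega>. f (Z \<omega>))" "(\<integral>\<omega>. f (Z \<omega>) \<partial>M) = (\<integral>\<omega>. Y \<omega> \<partial>M)"
proof -
  interpret sigma_finite_subalgebra M "vimage_algebra (space M) Z N"
    by (rule sigma_finite_subalgebra_vimage) fact
  have [measurable]: "f \<in> borel_measurable N"
    and AE: "AE \<omega> in M. f (Z \<omega>) = real_cond_exp M (vimage_algebra (space M) Z N) Y \<omega>"
    using f unfolding cond_expectation_def by auto
  show "integrable M (\<lambda>\<omega>. f (Z \<omega>))"
    using real_cond_exp_int(1)[OF Y] AE by (subst integrable_cong_AE) auto
  have "(\<integral>\<omega>. f (Z \<omega>) \<partial>M) = (\<integral>\<omega>. real_cond_exp M (vimage_algebra (space M) Z N) Y \<omega> \<partial>M)"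
    using AE by (intro integral_cong_AE) auto
  then show "(\<integral>\<omega>. f (Z \<omega>) \<partial>M) = (\<integral>\<omega>. Y \<omega> \<partial>M)"
    using real_cond_exp_int(2)[OF Y] by simp
qed

text \<open>The mean of the kernel depends on \<open>K\<close> alone and not on \<open>M\<close>. A
  kernel shared by several regimes thus yields a regression function shared by them.\<close>

lemma (in prob_space) cond_expectation_of_cond_distribution:
  assumes K: "cond_distribution M Z N Y borel K" and Y: "integrable M Y"
  shows "cond_expectation M Z N Y (\<lambda>z. \<integral>y. y \<partial>K z)"
proof -
  note Z [measurable] = cond_distributionD(1)[OF K] and [measurable] = cond_distributionD(2,3)[OF K]
  have K_sub: "K \<in> N \<rightarrow>\<^sub>M subprob_algebra borel"
    by (rule measurable_prob_algebraD) measurable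
  interpret sigma_finite_subalgebra M "vimage_algebra (space M) Z N"
    by (rule sigma_finite_subalgebra_vimage) fact
  define f where "f z = (\<integral>y. y \<partial>K z)" for z
  have f [measurable]: "f \<in> borel_measurable N"
    unfolding f_def by (rule integral_measurable_subprob_algebra2[OF _ K_sub]) measurable
  have "integrable (distr M N Z) f"
    using cond_distribution_integral(1)[OF K prob_space_axioms, of snd] Y unfolding f_def by simp
  then have int_f: "integrable M (\<lambda>\<omega>. f (Z \<omega>))"
    by (simp add: integrable_distr_eq)
  have "AE \<omega> in M. real_cond_exp M (vimage_algebra (space M) Z N) Y \<omega> = f (Z \<omega>)"
  proof (rule real_cond_exp_charact[OF _ Y int_f])
    have "Z \<in> vimage_algebra (space M) Z N \<rightarrow>\<^sub>M N"
      by (rule measurable_vimage_algebra1) (use measurable_space[OF Z] in auto)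
    then show "(\<lambda>\<omega>. f (Z \<omega>)) \<in> borel_measurable (vimage_algebra (space M) Z N)"
      by measurable
    \<comment> \<open>Every conditioning event is the preimage of some \<open>B\<close> under
      \<open>Z\<close>, so the characterizing identity is the disintegration of the function
      \<open>?g\<close> that maps \<open>(z, y)\<close> to \<open>indicator B z * y\<close>.\<close>
    fix A assume "A \<in> sets (vimage_algebra (space M) Z N)"
    then obtain B where [measurable]: "B \<in> sets N" and A: "A = Z -` B \<inter> space M"
      using measurable_space[OF Z] by (subst (asm) sets_vimage_algebra2) auto
    have "A \<in> sets M" unfolding A by measurable
    let ?g = "\<lambda>p. indicator B (fst p) * snd p :: real"
    have ind: "indicator A \<omega> * v = indicator B (Z \<omega>) * v" if "\<omega> \<in> space M" for \<omega> and v :: real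
      using that by (auto simp: A indicator_def)
    have "integrable M (\<lambda>\<omega>. indicator A \<omega> * Y \<omega>)"
      using integrable_mult_indicator[OF \<open>A \<in> sets M\<close> Y] by simp
    then have int: "integrable M (\<lambda>\<omega>. ?g (Z \<omega>, Y \<omega>))"
      using ind by (subst (asm) Bochner_Integration.integrable_cong[OF refl]) auto
    have "(\<integral>\<omega>\<in>A. Y \<omega> \<partial>M) = (\<integral>\<omega>. ?g (Z \<omega>, Y \<omega>) \<partial>M)"
      unfolding set_lebesgue_integral_def by (rule Bochner_Integration.integral_cong) (simp_all add: ind)
    also have "\<dots> = (\<integral>z. \<integral>y. ?g (z, y) \<partial>K z \<partial>distr M N Z)"
      by (rule cond_distribution_integral(2)[OF K prob_space_axioms _ int]) measurable
    also have "\<dots> = (\<integral>z. indicator B z * f z \<partial>distr M N Z)"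
      by (simp add: f_def)
    also have "\<dots> = (\<integral>\<omega>. indicator B (Z \<omega>) * f (Z \<omega>) \<partial>M)"
      by (rule integral_distr) measurable
    also have "\<dots> = (\<integral>\<omega>\<in>A. f (Z \<omega>) \<partial>M)"
      unfolding set_lebesgue_integral_def by (rule Bochner_Integration.integral_cong) (simp_all add: ind)
    finally show "(\<integral>\<omega>\<in>A. Y \<omega> \<partial>M) = (\<integral>\<omega>\<in>A. f (Z \<omega>) \<partial>M)" .
  qed
  then show ?thesis
    unfolding cond_expectation_def f_def[symmetric] by (auto elim: eventually_mono)
qed


section \<open>Subprocesses\<close>

lemma measurable_obs:
  assumes "\<And>u c. (u, c) \<in> I \<Longrightarrow> X u c \<in> borel_measurable M"
  shows "obs X I \<in> M \<rightarrow>\<^sub>M paths I"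
  unfolding obs_def paths_def
  by (rule measurable_restrict) (use assms in auto)

lemma measurable_restrict_paths:
  assumes "J \<subseteq> I"
  shows "(\<lambda>x. restrict x J) \<in> paths I \<rightarrow>\<^sub>M paths J"
  unfolding paths_def using assms by (rule measurable_restrict_subset)

lemma restrict_obs:
  assumes "J \<subseteq> I"
  shows "restrict (obs X I \<omega>) J = obs X J \<omega>"
  using assms by (simp add: obs_def Int_absorb1)

text \<open>Used to rebuild a path on \<open>past S t\<close> from its part on
  \<open>past_without S a t\<close> and a value for the coordinate \<open>(t, a)\<close>.\<close>

lemma measurable_paths_fun_upd:
  assumes "I = insert i J"
  shows "(\<lambda>p. (fst p)(i := snd p)) \<in> paths J \<Otimes>\<^sub>M borel \<rightarrow>\<^sub>M paths I"
  unfolding paths_def by (rule measurable_fun_upd[of _ J i]) (use assms in auto)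

text \<open>The law of the smaller collection is the image, under restriction, of the law of the
  larger one, and the latter is the same in all regimes.\<close>

lemma indep_regime_obs_mono:
  assumes indep: "indep_regime P R (obs X I) (paths I)" and "J \<subseteq> I"
    and meas: "\<And>r. r \<in> R \<Longrightarrow> obs X I \<in> P r \<rightarrow>\<^sub>M paths I"
  shows "indep_regime P R (obs X J) (paths J)"
  unfolding indep_regime_def
proof (intro ballI)
  have *: "distr (P r) (paths J) (obs X J)
      = distr (distr (P r) (paths I) (obs X I)) (paths J) (\<lambda>x. restrict x J)" if "r \<in> R" for r
    unfolding distr_distr[OF measurable_restrict_paths[OF \<open>J \<subseteq> I\<close>] meas[OF that]] comp_def
      restrict_obs[OF \<open>J \<subseteq> I\<close>] ..
  fix r r' assume "r \<in> R" "r' \<in> R"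
  then show "distr (P r) (paths J) (obs X J) = distr (P r') (paths J) (obs X J)"
    using indep unfolding indep_regime_def by (metis *)
qed

lemma past_eq_insert:
  assumes "a \<in> S"
  shows "past S t = insert (t, a) (past_without S a t)"
  using assms by (auto simp: past_def past_without_def)

lemma past_subset_past_without:
  assumes "C \<subseteq> S"
  shows "past C (t - 1) \<subseteq> past_without S a t"
  using assms by (auto simp: past_def past_without_def)

lemma past_without_subset:
  assumes "S \<subseteq> V" "a \<in> V"
  shows "past_without S a t \<subseteq> past V (t - 1) \<union> {t} \<times> (V - {a})"
  using assms by (auto simp: past_def past_without_def)

section \<open>Prescribed intervention laws as kernels on path spaces\<close>

lemma intervention_law_restrict:
  assumes "past (intervention_components s) (t - 1) \<subseteq> J"
  shows "intervention_law s t (restrict z J) = intervention_law s t z"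
  using assms by (cases s) (auto simp: Int_absorb1)

lemma measurable_intervention_law:
  assumes adm: "admissible_intervention V t s"
    and "past (intervention_components s) (t - 1) \<subseteq> J"
  shows "intervention_law s t \<in> paths J \<rightarrow>\<^sub>M prob_algebra borel"
proof (cases s)
  case (Atomic x)
  then have "intervention_law s t = (\<lambda>z. return borel x)"
    by (auto simp: fun_eq_iff)
  then show ?thesis by simp
next
  case (Conditional C g)
  then have *: "intervention_law s t = (\<lambda>z. return borel (g (restrict z (past C (t - 1)))))"
    by (auto simp: fun_eq_iff)
  have "g \<in> borel_measurable (paths (past C (t - 1)))"
    using adm Conditional by simp
  from measurable_compose[OF measurable_restrict_paths this, of J]
  have [measurable]: "(\<lambda>z. g (restrict z (past C (t - 1)))) \<in> borel_measurable (paths J)"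
    using assms Conditional by simp
  show ?thesis unfolding * by measurable
next
  case (Random C \<kappa>)
  then have *: "intervention_law s t = (\<lambda>z. \<kappa> (restrict z (past C (t - 1))))"
    by (auto simp: fun_eq_iff)
  show ?thesis
    unfolding * using assms Random by (intro measurable_compose[OF measurable_restrict_paths]) auto
qed

text \<open>Treats atomic and conditional interventions together: both prescribe a point mass, at a
  constant or at a function of the past. The restriction property records that \<open>G\<close>
  reads only the past of the intervention components, so that it can be evaluated on paths over
  different index sets.\<close>

lemma intervention_law_deterministic:
  assumes "admissible_intervention V t s" "\<nexists>C \<kappa>. s = Random C \<kappa>"
  obtains G where "intervention_law s t = (\<lambda>z. return borel (G z))"
    "\<And>z J. past (intervention_components s) (t - 1) \<subseteq> J \<Longrightarrow> G (restrict z J) = G z"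
    "\<And>J. past (intervention_components s) (t - 1) \<subseteq> J \<Longrightarrow> G \<in> borel_measurable (paths J)"
proof (cases s)
  case (Atomic x)
  show ?thesis
    by (rule that[of "\<lambda>_. x"]) (use Atomic in \<open>auto simp: fun_eq_iff\<close>)
next
  case (Conditional C g)
  show ?thesis
  proof (rule that[of "\<lambda>z. g (restrict z (past C (t - 1)))"])
    show "intervention_law s t = (\<lambda>z. return borel (g (restrict z (past C (t - 1)))))"
      using Conditional by (auto simp: fun_eq_iff)
    show "g (restrict (restrict z J) (past C (t - 1))) = g (restrict z (past C (t - 1)))"
      if "past (intervention_components s) (t - 1) \<subseteq> J" for z J
      using that Conditional by (simp add: Int_absorb1)
    show "(\<lambda>z. g (restrict z (past C (t - 1)))) \<in> borel_measurable (paths J)"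
      if "past (intervention_components s) (t - 1) \<subseteq> J" for J
      using that Conditional assms(1) by (intro measurable_compose[OF measurable_restrict_paths]) auto
  qed
next
  case (Random C \<kappa>)
  then show ?thesis using assms(2) by auto
qed

text \<open>Condition (4) enters here: it puts every coordinate that the prescribed law reads into
  \<open>past_without S a t\<close>. For a random intervention the law given the larger vector can
  then be coarsened to this index set.\<close>

lemma draw_law_intervention_law:
  assumes "prob_space (P (Do s))"
    and meas: "\<And>u c. c \<in> V \<Longrightarrow> X u c \<in> borel_measurable (P (Do s))"
    and under: "under_intervention P V X a t s"
    and "a \<in> S" "S \<subseteq> V" and comp: "intervention_components s \<subseteq> S"
    and ignore: "(\<exists>C \<kappa>. s = Random C \<kappa>) \<Longrightarrow> draw_ignores_present P V X a t s"
  shows "draw_law P X S a t s (intervention_law s t)"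
proof -
  let ?W = "past_without S a t" and ?I = "past V (t - 1) \<union> {t} \<times> (V - {a})"
  have adm: "admissible_intervention V t s"
    and cd: "cond_distribution (P (Do s)) (obs X (past V (t - 1))) (paths (past V (t - 1)))
       (X t a) borel (intervention_law s t)"
    using under unfolding under_intervention_def by auto
  have W: "past (intervention_components s) (t - 1) \<subseteq> ?W"
    using comp by (rule past_subset_past_without)
  have W_I: "?W \<subseteq> ?I"
    using assms by (intro past_without_subset) auto
  show ?thesis
  proof (cases "\<exists>C \<kappa>. s = Random C \<kappa>")
    case True
    then have "cond_distribution (P (Do s)) (obs X ?I) (paths ?I) (X t a) borel (intervention_law s t)"
      using ignore unfolding draw_ignores_present_def Let_def by simp
    \<comment> \<open>Restricting to \<open>?W\<close> first leaves the law unchanged and brings the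
      kernel into the form \<open>K (\<pi> z)\<close> that coarsening expects.\<close>
    then have "cond_distribution (P (Do s)) (obs X ?I) (paths ?I) (X t a) borel
        (\<lambda>z. intervention_law s t (restrict z ?W))"
      by (simp add: intervention_law_restrict[OF W])
    from cond_distribution_coarsen[OF this measurable_restrict_paths[OF W_I]
        measurable_intervention_law[OF adm W]]
    show ?thesis
      unfolding draw_law_def by (simp add: restrict_obs[OF W_I])
  next
    \<comment> \<open>A point mass makes $X_a(t)$ almost surely a function of the past of \<open>S\<close>, so conditioning
      additionally on contemporaneous variables cannot change its law.\<close>
    case False
    from intervention_law_deterministic[OF adm False] obtain G
      where law: "intervention_law s t = (\<lambda>z. return borel (G z))"
        and G_restrict: "\<And>z J. past (intervention_components s) (t - 1) \<subseteq> J \<Longrightarrow> G (restrict z J) = G z"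
        and G_meas: "\<And>J. past (intervention_components s) (t - 1) \<subseteq> J \<Longrightarrow> G \<in> borel_measurable (paths J)"
      by blast
    have V: "past (intervention_components s) (t - 1) \<subseteq> past V (t - 1)"
      using comp \<open>S \<subseteq> V\<close> by (auto simp: past_def)
    \<comment> \<open>Both index sets contain the past that \<open>G\<close> reads, so both sides
      reduce to \<open>G\<close> at the path observed on that common part.\<close>
    have G_obs: "G (obs X (past V (t - 1)) \<omega>) = G (obs X ?W \<omega>)" for \<omega>
    proof -
      have "G (obs X (past V (t - 1)) \<omega>) = G (obs X (past (intervention_components s) (t - 1)) \<omega>)"
        using G_restrict[OF subset_refl, of "obs X (past V (t - 1)) \<omega>"] restrict_obs[OF V, of X \<omega>] by simp
      also have "\<dots> = G (obs X ?W \<omega>)"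
        using G_restrict[OF subset_refl, of "obs X ?W \<omega>"] restrict_obs[OF W, of X \<omega>] by simp
      finally show ?thesis .
    qed
    have "AE \<omega> in P (Do s). X t a \<omega> = G (obs X (past V (t - 1)) \<omega>)"
      using cd unfolding law by (rule cond_distribution_return_AE[OF _ \<open>prob_space (P (Do s))\<close> G_meas[OF V]])
    then have "AE \<omega> in P (Do s). X t a \<omega> = G (obs X ?W \<omega>)"
      by (simp add: G_obs)
    moreover have "obs X ?W \<in> P (Do s) \<rightarrow>\<^sub>M paths ?W"
      using assms by (intro measurable_obs meas) (auto simp: past_def past_without_def)
    moreover have "X t a \<in> borel_measurable (P (Do s))"
      using assms by (intro meas) auto
    ultimately show ?thesis
      unfolding draw_law_def law by (intro cond_distribution_return G_meas[OF W])
  qed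
qed

section \<open>The adjustment formula and identification of the causal effect\<close>

lemma integral_eq_adjustment_functional:
  assumes "prob_space (P (Do s))"
    and meas: "\<And>u c. c \<in> S \<Longrightarrow> X u c \<in> borel_measurable (P Idle)"
    and draw: "draw_law P X S a t s Q"
    and same: "distr (P (Do s)) (paths (past_without S a t)) (obs X (past_without S a t))
      = distr (P Idle) (paths (past_without S a t)) (obs X (past_without S a t))"
    and "a \<in> S" and f [measurable]: "f \<in> borel_measurable (paths (past S t))"
    and int: "integrable (P (Do s)) (\<lambda>\<omega>. f (obs X (past S t) \<omega>))"
  shows "(\<integral>\<omega>. f (obs X (past S t) \<omega>) \<partial>P (Do s))
    = adjustment_functional (distr (P Idle) (paths (UNIV \<times> S)) (obs X (UNIV \<times> S))) S a t f Q"
proof -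
  let ?W = "past_without S a t"
  have cd: "cond_distribution (P (Do s)) (obs X ?W) (paths ?W) (X t a) borel Q"
    using draw unfolding draw_law_def .
  have Q: "Q \<in> paths ?W \<rightarrow>\<^sub>M subprob_algebra borel"
    by (rule measurable_prob_algebraD[OF cond_distributionD(3)[OF cd]])
  have W_S: "?W \<subseteq> UNIV \<times> S" and past_S: "past S t \<subseteq> UNIV \<times> S"
    using \<open>a \<in> S\<close> by (auto simp: past_def past_without_def)
  have insert: "past S t = insert (t, a) ?W"
    by (rule past_eq_insert) fact
  \<comment> \<open>\<open>F\<close> is \<open>f\<close> with its argument split into the part on
    \<open>?W\<close> and the coordinate \<open>(t, a)\<close>; in this form it can be disintegrated
    along \<open>Q\<close>.\<close>
  define F where "F p = f ((fst p)((t, a) := snd p))" for p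
  have F [measurable]: "F \<in> borel_measurable (paths ?W \<Otimes>\<^sub>M borel)"
    unfolding F_def by (rule measurable_compose[OF measurable_paths_fun_upd f]) (rule insert)
  have obs_W [measurable]: "obs X ?W \<in> P Idle \<rightarrow>\<^sub>M paths ?W"
    using W_S by (intro measurable_obs meas) auto
  have obs_S [measurable]: "obs X (UNIV \<times> S) \<in> P Idle \<rightarrow>\<^sub>M paths (UNIV \<times> S)"
    by (intro measurable_obs meas) auto
  have inner [measurable]: "(\<lambda>z. \<integral>y. F (z, y) \<partial>Q z) \<in> borel_measurable (paths ?W)"
    by (rule integral_measurable_subprob_algebra2[OF _ Q]) measurable
  have F_obs: "f (obs X (past S t) \<omega>) = F (obs X ?W \<omega>, X t a \<omega>)" for \<omega>
    unfolding F_def insert by (rule arg_cong[where f=f]) (auto simp: obs_def fun_eq_iff)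
  \<comment> \<open>The update overwrites the coordinate \<open>(t, a)\<close>, the only one where the two restrictions differ.\<close>
  have upd: "f ((restrict x (past S t))((t, a) := y)) = F (restrict x ?W, y)" for x y
    unfolding F_def insert by (rule arg_cong[where f=f]) (auto simp: fun_eq_iff)
  have "(\<integral>\<omega>. f (obs X (past S t) \<omega>) \<partial>P (Do s)) = (\<integral>\<omega>. F (obs X ?W \<omega>, X t a \<omega>) \<partial>P (Do s))"
    by (simp add: F_obs)
  also have "\<dots> = (\<integral>z. \<integral>y. F (z, y) \<partial>Q z \<partial>distr (P (Do s)) (paths ?W) (obs X ?W))"
    by (rule cond_distribution_integral(2)[OF cd \<open>prob_space (P (Do s))\<close>]) (use int in \<open>auto simp: F_obs\<close>)
  \<comment> \<open>The change of regime: once \<open>Q\<close> has absorbed the coordinate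
    \<open>(t, a)\<close>, only the law of the variables in \<open>?W\<close> remains, and
    \<open>same\<close> replaces it by the idle one.\<close>
  also have "\<dots> = (\<integral>\<omega>. \<integral>y. F (obs X ?W \<omega>, y) \<partial>Q (obs X ?W \<omega>) \<partial>P Idle)"
    unfolding same by (rule integral_distr) measurable
  \<comment> \<open>The functional takes the idle law of the whole subprocess \<open>X_S\<close>, so
    the variables in \<open>?W\<close> are recovered from it by restriction.\<close>
  also have "\<dots> = (\<integral>\<omega>. \<integral>y. F (restrict (obs X (UNIV \<times> S) \<omega>) ?W, y)
      \<partial>Q (restrict (obs X (UNIV \<times> S) \<omega>) ?W) \<partial>P Idle)"
    by (simp add: restrict_obs[OF W_S])
  also have "\<dots> = (\<integral>x. \<integral>y. F (restrict x ?W, y) \<partial>Q (restrict x ?W)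
      \<partial>distr (P Idle) (paths (UNIV \<times> S)) (obs X (UNIV \<times> S)))"
    by (rule integral_distr[symmetric, OF obs_S])
       (rule measurable_compose[OF measurable_restrict_paths[OF W_S] inner])
  also have "\<dots> = adjustment_functional (distr (P Idle) (paths (UNIV \<times> S)) (obs X (UNIV \<times> S))) S a t f Q"
    unfolding adjustment_functional_def upd ..
  finally show ?thesis .
qed

theorem theorem3p1:
  fixes d a b :: nat and V S :: "nat set" and t :: int
    and P :: "regime \<Rightarrow> 'w measure" and X :: "int \<Rightarrow> nat \<Rightarrow> 'w \<Rightarrow> real"
    and s :: intervention and R :: "regime set"
  defines "V \<equiv> {1..d}" and "R \<equiv> {Idle, Do s}"
  assumes "a \<in> S" and "b \<in> S" and "S \<subseteq> V"
    and "process_under_regimes P R V X"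
    and "stationary (P Idle) V X" and "mixing (P Idle) V X" and "ac_transitions (P Idle) V X"
    and "under_intervention P V X a t s"
    and "\<And>h r. h \<ge> 1 \<Longrightarrow> r \<in> R \<Longrightarrow> integrable (P r) (X (t + int h) b)"
    and cond1: "indep_regime P R
                  (obs X (past V (t - 1) \<union> {t} \<times> (V - {a}))) (paths (past V (t - 1) \<union> {t} \<times> (V - {a})))"
    and cond2: "cond_indep_regime P R
                  (obs X (future V t)) (paths (future V t)) (obs X (past V t)) (paths (past V t))"
    and cond3: "\<And>h. h \<ge> 1 \<Longrightarrow> cond_indep_regime P R
                  (X (t + int h) b) borel (obs X (past S t)) (paths (past S t))"
    and cond4: "intervention_components s \<subseteq> S"
  shows "\<forall>h\<ge>1.
           identifies_effect P V X S a b t h s \<and>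
           (\<forall>f. common_cond_expectation P R X S b t h f \<longrightarrow>
              (let W = past_without S a t;
                   middle = cond_expectation (P (Do s)) (obs X W) (paths W) (\<lambda>\<omega>. f (obs X (past S t) \<omega>))
               in (\<exists>g. middle g) \<and>
                  (\<forall>g. middle g \<longrightarrow> ACE P X s b t h = (\<integral>\<omega>. g (obs X W \<omega>) \<partial>P Idle))))"
proof (intro allI impI)
  fix h :: nat assume h: "h \<ge> 1"
  let ?W = "past_without S a t"
  let ?Y = "X (t + int h) b"
  have prob: "prob_space (P r)" and meas: "\<And>u c. c \<in> V \<Longrightarrow> X u c \<in> borel_measurable (P r)" if "r \<in> R" for r
    using assms(6) that unfolding process_under_regimes_def by auto
  have R: "Idle \<in> R" "Do s \<in> R" by (auto simp: R_def)
  interpret s: prob_space "P (Do s)" using prob[OF R(2)] .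
  have int: "integrable (P r) ?Y" if "r \<in> R" for r
    using assms(11)[OF h that] .
  have obs_meas: "obs X I \<in> P r \<rightarrow>\<^sub>M paths I" if "r \<in> R" "I \<subseteq> UNIV \<times> V" for r I
    using that by (intro measurable_obs meas) auto
  have W_V: "?W \<subseteq> UNIV \<times> V" and past_V: "past S t \<subseteq> UNIV \<times> V"
    using \<open>a \<in> S\<close> \<open>S \<subseteq> V\<close> by (auto simp: past_def past_without_def)
  \<comment> \<open>\<open>?W\<close> contains component \<open>a\<close> only up to time
    \<open>t - 1\<close>, hence avoids \<open>(t, a)\<close>, the coordinate at time
    \<open>t\<close> that (1) leaves out.\<close>
  have "indep_regime P R (obs X ?W) (paths ?W)"
    using cond1
  proof (rule indep_regime_obs_mono)
    show "?W \<subseteq> past V (t - 1) \<union> {t} \<times> (V - {a})"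
      using \<open>a \<in> S\<close> \<open>S \<subseteq> V\<close> by (intro past_without_subset) auto
  qed (intro obs_meas, auto simp: past_def)
  then have same: "distr (P (Do s)) (paths ?W) (obs X ?W) = distr (P Idle) (paths ?W) (obs X ?W)"
    using R unfolding indep_regime_def by blast
  have ex: "\<exists>f. common_cond_expectation P R X S b t h f"
  proof -
    \<comment> \<open>The kernel from (3) is valid in both regimes; its mean is the witness for the
      common regression function.\<close>
    obtain K where "\<And>r. r \<in> R \<Longrightarrow> cond_distribution (P r) (obs X (past S t)) (paths (past S t)) ?Y borel K"
      using cond3[OF h] unfolding cond_indep_regime_def by auto
    then have "common_cond_expectation P R X S b t h (\<lambda>z. \<integral>y. y \<partial>K z)"
      unfolding common_cond_expectation_def
      using prob_space.cond_expectation_of_cond_distribution[OF prob] int by blast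
    then show ?thesis by blast
  qed
  have common: "f \<in> borel_measurable (paths (past S t))"
    "integrable (P (Do s)) (\<lambda>\<omega>. f (obs X (past S t) \<omega>))"
    "ACE P X s b t h = (\<integral>\<omega>. f (obs X (past S t) \<omega>) \<partial>P (Do s))"
    if "common_cond_expectation P R X S b t h f" for f
  proof -
    have f: "cond_expectation (P (Do s)) (obs X (past S t)) (paths (past S t)) ?Y f"
      using that R(2) unfolding common_cond_expectation_def by auto
    then show "f \<in> borel_measurable (paths (past S t))"
      unfolding cond_expectation_def by auto
    show "integrable (P (Do s)) (\<lambda>\<omega>. f (obs X (past S t) \<omega>))"
      "ACE P X s b t h = (\<integral>\<omega>. f (obs X (past S t) \<omega>) \<partial>P (Do s))"
      using s.cond_expectation_integral[OF obs_meas[OF R(2) past_V] int[OF R(2)] f]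
      unfolding ACE_def by auto
  qed
  have "identifies_effect P V X S a b t h s"
    unfolding identifies_effect_def R_def[symmetric]
  proof (intro conjI allI impI)
    show "\<exists>f. common_cond_expectation P R X S b t h f" by (rule ex)
    show "ACE P X s b t h
        = adjustment_functional (distr (P Idle) (paths (UNIV \<times> S)) (obs X (UNIV \<times> S))) S a t f Q"
      if "common_cond_expectation P R X S b t h f \<and> draw_law P X S a t s Q" for f Q
    proof -
      have f: "common_cond_expectation P R X S b t h f" and Q: "draw_law P X S a t s Q"
        using that by auto
      show ?thesis
        unfolding common(3)[OF f]
      proof (rule integral_eq_adjustment_functional[where P=P and s=s, OF s.prob_space_axioms _ Q same])
        show "X u c \<in> borel_measurable (P Idle)" if "c \<in> S" for u c
          using meas[OF R(1)] that \<open>S \<subseteq> V\<close> by blast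
      qed (fact \<open>a \<in> S\<close> common(1)[OF f] common(2)[OF f])+
    qed
    show "draw_law P X S a t s (intervention_law s t)"
      if "(\<exists>C \<kappa>. s = Random C \<kappa>) \<longrightarrow> draw_ignores_present P V X a t s"
    proof (rule draw_law_intervention_law[where P=P and s=s, OF s.prob_space_axioms])
      show "X u c \<in> borel_measurable (P (Do s))" if "c \<in> V" for u c
        using meas[OF R(2) that] .
      show "draw_ignores_present P V X a t s" if "\<exists>C \<kappa>. s = Random C \<kappa>"
        using \<open>(\<exists>C \<kappa>. s = Random C \<kappa>) \<longrightarrow> draw_ignores_present P V X a t s\<close> that by (rule mp)
    qed (fact \<open>under_intervention P V X a t s\<close> \<open>a \<in> S\<close> \<open>S \<subseteq> V\<close> cond4)+
  qed
  \<comment> \<open>Here the middle expectation is an arbitrary version \<open>g\<close>, not an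
    integral against a kernel. The tower property applied to \<open>f\<close> of the observed past
    of \<open>S\<close>, followed by the equality of the laws on \<open>?W\<close>, carries the
    outer expectation to the idle regime.\<close>
  moreover have "ACE P X s b t h = (\<integral>\<omega>. g (obs X ?W \<omega>) \<partial>P Idle)"
    if f: "common_cond_expectation P R X S b t h f"
      and g: "cond_expectation (P (Do s)) (obs X ?W) (paths ?W) (\<lambda>\<omega>. f (obs X (past S t) \<omega>)) g" for f g
  proof -
    have g_meas: "g \<in> borel_measurable (paths ?W)"
      using g unfolding cond_expectation_def by auto
    have "ACE P X s b t h = (\<integral>\<omega>. g (obs X ?W \<omega>) \<partial>P (Do s))"
      using s.cond_expectation_integral(2)[OF obs_meas[OF R(2) W_V] common(2)[OF f] g] common(3)[OF f]
      by simp
    also have "\<dots> = (\<integral>z. g z \<partial>distr (P (Do s)) (paths ?W) (obs X ?W))"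
      by (rule integral_distr[OF obs_meas[OF R(2) W_V] g_meas, symmetric])
    also have "\<dots> = (\<integral>\<omega>. g (obs X ?W \<omega>) \<partial>P Idle)"
      unfolding same by (rule integral_distr[OF obs_meas[OF R(1) W_V] g_meas])
    finally show ?thesis .
  qed
  ultimately show "identifies_effect P V X S a b t h s \<and>
      (\<forall>f. common_cond_expectation P R X S b t h f \<longrightarrow>
        (let W = past_without S a t;
             middle = cond_expectation (P (Do s)) (obs X W) (paths W) (\<lambda>\<omega>. f (obs X (past S t) \<omega>))
         in (\<exists>g. middle g) \<and> (\<forall>g. middle g \<longrightarrow> ACE P X s b t h = (\<integral>\<omega>. g (obs X W \<omega>) \<partial>P Idle))))"
    unfolding Let_def using s.ex_cond_expectation[OF obs_meas[OF R(2) W_V]] by auto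
qed

end
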